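(* Let $u\in R(\mathbb{R})^+$ be a unit vector and $\gamma=\begin{pmatrix}a&b\\c&d\end{pmatrix}\in G(\mathbb{R})$. Then $$\kappa(\gamma.S_u)=cu\bar d+d\bar u\,\bar c,\qquad \kappa'(\gamma.S_u)=au\bar b+b\bar u\,\bar a,\qquad \xi(\gamma.S_u)=au\bar d+b\bar u\,\bar c.$$
   Context: Fix $\dim\in\{3,4,5\}$. $R(\mathbb{R})$ is $\mathbb{C}$ if $\dim=3$ and the Hamilton quaternions $H_\mathbb{R}$ if $\dim=4,5$, with standard conjugation $\bar\cdot$ and $\mathrm{nrm}(x)=x\bar x$. $R(\mathbb{R})^+$ is $\mathbb{C}$ ($\dim=3$), the subspace $\{x+yi+zj\}$ of elements fixed by the orthogonal involution $(x+yi+zj+tij)^\ddagger=x+yi+zj-tij$ ($\dim=4$), or $H_\mathbb{R}$ ($\dim=5$), viewed as Euclidean $\mathbb{R}^{\dim-1}$ with norm $\sqrt{\mathrm{nrm}}$. $G(\mathbb{R})$ is $SL(2,\mathbb{C})$ ($\dim=3$), $SL^\ddagger(2,H_\mathbb{R})=\{M:\hat\ddagger(M)M=M\hat\ddagger(M)=I\}$ with $\hat\ddagger\begin{pmatrix}a&b\\c&d\end{pmatrix}=\begin{pmatrix}d^\ddagger&-b^\ddagger\\-c^\ddagger&a^\ddagger\end{pmatrix}$ ($\dim=4$), or $SL(2,H_\mathbb{R})$ = matrices over $H_\mathbb{R}$ with determinant $1$ as $4\times4$ complex matrices ($\dim=5$); it acts on $R(\mathbb{R})^+\cup\{\infty\}$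 by $\rho\mapsto(a\rho+b)(c\rho+d)^{-1}$ and hence on oriented spheres. $S_u$ is the hyperplane through $0$ with normal vector $u$, oriented so that $u$ lies in its interior. For an oriented sphere $S$: the bend $\kappa(S)$ is $1/\text{radius}$, positive if the interior is the bounded ball and negative otherwise, $0$ for hyperplanes; the co-bend $\kappa'(S)$ is the bend of the image of $S$ under $z\mapsto-z^{-1}$; the bend-center $\xi(S)$ is $\kappa(S)$ times the center, or, for a hyperplane, the unit normal pointing into the interior. *)

theory Defs
  imports "HOL-Analysis.Analysis"
begin

section \<open>Hamilton's quaternions\<close>

text \<open>The element \<open>Quat x y z t\<close> is \<open>x + y i + z j + t i j\<close>, where \<open>i\<^sup>2 = j\<^sup>2 = -1\<close> and \<open>j i = - i j\<close>.\<close>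

datatype quat = Quat (qRe: real) (qI: real) (qJ: real) (qK: real)

lemma quat_eq_iff: "x = y \<longleftrightarrow> qRe x = qRe y \<and> qI x = qI y \<and> qJ x = qJ y \<and> qK x = qK y"
  by (cases x; cases y) simp

instantiation quat :: ring_1
begin

definition "0 = Quat 0 0 0 0"
definition "1 = Quat 1 0 0 0"
definition "x + y = Quat (qRe x + qRe y) (qI x + qI y) (qJ x + qJ y) (qK x + qK y)"
definition "- x = Quat (- qRe x) (- qI x) (- qJ x) (- qK x)"
definition "x - y = Quat (qRe x - qRe y) (qI x - qI y) (qJ x - qJ y) (qK x - qK y)"
definition "x * y = Quat
  (qRe x * qRe y - qI x * qI y - qJ x * qJ y - qK x * qK y)
  (qRe x * qI y + qI x * qRe y + qJ x * qK y - qK x * qJ y)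
  (qRe x * qJ y - qI x * qK y + qJ x * qRe y + qK x * qI y)
  (qRe x * qK y + qI x * qJ y - qJ x * qI y + qK x * qRe y)"

lemmas quat_ring_defs =
  zero_quat_def one_quat_def plus_quat_def uminus_quat_def minus_quat_def times_quat_def

instance
  by standard (simp_all add: quat_ring_defs quat_eq_iff algebra_simps)

end

lemma quat_sel [simp]:
  "qRe 0 = 0" "qI 0 = 0" "qJ 0 = 0" "qK 0 = 0"
  "qRe 1 = 1" "qI 1 = 0" "qJ 1 = 0" "qK 1 = 0"
  "qRe (x + y) = qRe x + qRe y" "qI (x + y) = qI x + qI y"
  "qJ (x + y) = qJ x + qJ y" "qK (x + y) = qK x + qK y"
  "qRe (- x) = - qRe x" "qI (- x) = - qI x" "qJ (- x) = - qJ x" "qK (- x) = - qK x"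
  "qRe (x - y) = qRe x - qRe y" "qI (x - y) = qI x - qI y"
  "qJ (x - y) = qJ x - qJ y" "qK (x - y) = qK x - qK y"
  "qRe (x * y) = qRe x * qRe y - qI x * qI y - qJ x * qJ y - qK x * qK y"
  "qI (x * y) = qRe x * qI y + qI x * qRe y + qJ x * qK y - qK x * qJ y"
  "qJ (x * y) = qRe x * qJ y - qI x * qK y + qJ x * qRe y + qK x * qI y"
  "qK (x * y) = qRe x * qK y + qI x * qJ y - qJ x * qI y + qK x * qRe y"
  by (simp_all add: quat_ring_defs)

instantiation quat :: real_inner
begin

definition "r *\<^sub>R x = Quat (r * qRe x) (r * qI x) (r * qJ x) (r * qK x)"
definition "inner x y = qRe x * qRe y + qI x * qI y + qJ x * qJ y + qK x * qK y"
definition "norm (x::quat) = sqrt (inner x x)"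
definition "sgn (x::quat) = inverse (norm x) *\<^sub>R x"
definition "dist x y = norm (x - y :: quat)"
definition "(uniformity :: (quat \<times> quat) filter) = (INF e\<in>{0 <..}. principal {(x, y). dist x y < e})"
definition "open (U :: quat set) \<longleftrightarrow> (\<forall>x\<in>U. eventually (\<lambda>(x', y). x' = x \<longrightarrow> y \<in> U) uniformity)"

instance
proof
  fix x :: quat
  show "0 \<le> inner x x"
    by (simp add: inner_quat_def)
  show "inner x x = 0 \<longleftrightarrow> x = 0"
    by (auto simp: inner_quat_def quat_eq_iff add_nonneg_eq_0_iff)
qed (simp_all add: scaleR_quat_def inner_quat_def norm_quat_def sgn_quat_def dist_quat_def
      uniformity_quat_def open_quat_def quat_eq_iff algebra_simps)

end

lemma quat_sel_scaleR [simp]: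
  "qRe (r *\<^sub>R x) = r * qRe x" "qI (r *\<^sub>R x) = r * qI x"
  "qJ (r *\<^sub>R x) = r * qJ x" "qK (r *\<^sub>R x) = r * qK x"
  by (simp_all add: scaleR_quat_def)

definition qcnj :: "quat \<Rightarrow> quat"
  where "qcnj x = Quat (qRe x) (- qI x) (- qJ x) (- qK x)"

definition qdagger :: "quat \<Rightarrow> quat"
  where "qdagger x = Quat (qRe x) (qI x) (qJ x) (- qK x)"

instantiation quat :: real_normed_div_algebra
begin

definition "inverse x = inverse (inner x x) *\<^sub>R qcnj x"
definition "x div y = x * inverse (y :: quat)"

instance
proof
  fix x y :: quat
  have *: "inner x x \<noteq> 0" if "x \<noteq> 0"
    using that by simp
  show "inverse x * x = 1" "x * inverse x = 1" if "x \<noteq> 0"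
    using *[OF that]
    by (simp_all add: inverse_quat_def qcnj_def quat_eq_iff field_simps)
      (simp_all add: inner_quat_def)
  have "inner (x * y) (x * y) = inner x x * inner y y"
    by (simp add: inner_quat_def algebra_simps)
  then show "norm (x * y) = norm x * norm y"
    by (simp add: norm_quat_def real_sqrt_mult)
qed (simp_all add: inverse_quat_def divide_quat_def quat_eq_iff qcnj_def algebra_simps)

end

text \<open>The Euclidean norm is the square root of \<open>nrm x = x * qcnj x\<close>.\<close>

lemma mult_qcnj: "x * qcnj x = of_real ((norm x)\<^sup>2)"
  by (simp add: norm_quat_def of_real_def quat_eq_iff qcnj_def inner_quat_def)


section \<open>The groups and their action\<close>

definition mat2 :: "'a::zero \<Rightarrow> 'a \<Rightarrow> 'a \<Rightarrow> 'a \<Rightarrow> 'a^2^2"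
  where "mat2 a b c d = vector [vector [a, b], vector [c, d]]"

definition SL2_C :: "(complex^2^2) set"
  where "SL2_C = {M. det M = 1}"

definition hat_dagger :: "quat^2^2 \<Rightarrow> quat^2^2"
  where "hat_dagger M = mat2 (qdagger (M$2$2)) (- qdagger (M$1$2)) (- qdagger (M$2$1)) (qdagger (M$1$1))"

definition SL2_dagger_H :: "(quat^2^2) set"
  where "SL2_dagger_H = {M. hat_dagger M ** M = mat 1 \<and> M ** hat_dagger M = mat 1}"

text \<open>Writing \<open>q = \<alpha> + \<beta> j\<close> with \<open>\<alpha>, \<beta>\<close> complex, \<open>q\<close> corresponds to the complex
  \<open>2 \<times> 2\<close> block with rows \<open>\<alpha>, \<beta>\<close> and \<open>- cnj \<beta>, cnj \<alpha>\<close>.\<close>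

definition qalpha :: "quat \<Rightarrow> complex"
  where "qalpha q = Complex (qRe q) (qI q)"

definition qbeta :: "quat \<Rightarrow> complex"
  where "qbeta q = Complex (qJ q) (qK q)"

definition complex_matrix :: "quat^2^2 \<Rightarrow> complex^4^4"
  where "complex_matrix M = vector
   [vector [qalpha (M$1$1), qbeta (M$1$1), qalpha (M$1$2), qbeta (M$1$2)],
    vector [- cnj (qbeta (M$1$1)), cnj (qalpha (M$1$1)), - cnj (qbeta (M$1$2)), cnj (qalpha (M$1$2))],
    vector [qalpha (M$2$1), qbeta (M$2$1), qalpha (M$2$2), qbeta (M$2$2)],
    vector [- cnj (qbeta (M$2$1)), cnj (qalpha (M$2$1)), - cnj (qbeta (M$2$2)), cnj (qalpha (M$2$2))]]"

definition SL2_H :: "(quat^2^2) set"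
  where "SL2_H = {M. det (complex_matrix M) = 1}"

text \<open>The point \<open>\<infinity>\<close> is \<open>None\<close>.\<close>

fun moebius :: "'a::division_ring^2^2 \<Rightarrow> 'a option \<Rightarrow> 'a option"
  where
    "moebius M None = (if M$2$1 = 0 then None else Some (M$1$1 * inverse (M$2$1)))"
  | "moebius M (Some z) = (if M$2$1 * z + M$2$2 = 0 then None
      else Some ((M$1$1 * z + M$1$2) * inverse (M$2$1 * z + M$2$2)))"


section \<open>Oriented spheres in a Euclidean subspace\<close>

text \<open>An oriented sphere is represented by the pair of its point set and its interior, both as
  subsets of the one-point extension of a subspace \<open>V\<close>; hyperplanes contain \<open>\<infinity>\<close>.\<close>

type_synonym 'a osphere = "'a option set \<times> 'a option set"

definition inner_sphere :: "'a::real_inner set \<Rightarrow> 'a \<Rightarrow> real \<Rightarrow> 'a osphere"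
  where "inner_sphere V p r = (Some ` (V \<inter> sphere p r), Some ` (V \<inter> ball p r))"

definition outer_sphere :: "'a::real_inner set \<Rightarrow> 'a \<Rightarrow> real \<Rightarrow> 'a osphere"
  where "outer_sphere V p r = (Some ` (V \<inter> sphere p r), insert None (Some ` (V - cball p r)))"

definition hyperplane :: "'a::real_inner set \<Rightarrow> 'a \<Rightarrow> real \<Rightarrow> 'a osphere"
  where "hyperplane V n t =
    (insert None (Some ` {z \<in> V. inner n z = t}), Some ` {z \<in> V. inner n z > t})"

abbreviation S_u :: "'a::real_inner set \<Rightarrow> 'a \<Rightarrow> 'a osphere"
  where "S_u V u \<equiv> hyperplane V u 0"

definition act :: "'a::{division_ring,real_inner}^2^2 \<Rightarrow> 'a osphere \<Rightarrow> 'a osphere"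
  where "act M S = (moebius M ` fst S, moebius M ` snd S)"

definition bend :: "'a::real_inner set \<Rightarrow> 'a osphere \<Rightarrow> real"
  where "bend V S = (THE k.
    (\<exists>p\<in>V. \<exists>r>0. S = inner_sphere V p r \<and> k = 1 / r) \<or>
    (\<exists>p\<in>V. \<exists>r>0. S = outer_sphere V p r \<and> k = - 1 / r) \<or>
    (\<exists>n\<in>V. \<exists>t. norm n = 1 \<and> S = hyperplane V n t \<and> k = 0))"

text \<open>The matrix \<open>mat2 0 (-1) 1 0\<close> acts by \<open>z \<mapsto> - z\<inverse>\<close>.\<close>

definition cobend :: "'a::{division_ring,real_inner} set \<Rightarrow> 'a osphere \<Rightarrow> real"
  where "cobend V S = bend V (act (mat2 0 (-1) 1 0) S)"

definition bend_center :: "'a::real_inner set \<Rightarrow> 'a osphere \<Rightarrow> 'a"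
  where "bend_center V S = (THE x.
    (\<exists>p\<in>V. \<exists>r>0. (S = inner_sphere V p r \<or> S = outer_sphere V p r) \<and> x = bend V S *\<^sub>R p) \<or>
    (\<exists>n\<in>V. \<exists>t. norm n = 1 \<and> S = hyperplane V n t \<and> x = n))"

text \<open>The space \<open>R(\<real>)\<^sup>+\<close> in ambient dimension 4; in dimensions 3 and 5 it is the whole type.\<close>

definition Rplus4 :: "quat set"
  where "Rplus4 = {x. qdagger x = x}"

end

theory Submission
  imports Defs
begin

text \<open>In homogeneous coordinates \<open>z = x y\<^sup>-\<^sup>1\<close>, the inequality \<open>2 \<langle>u, x cj y\<rangle> > 0\<close> describes the interior of
  \<open>S_u\<close>. Write \<open>p = a x + b y\<close>, \<open>q = c x + d y\<close> and let \<open>\<kappa>, \<kappa>', \<xi>\<close> be the right-hand sides of the three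
  formulas. Then \<open>2 \<langle>\<xi>, p cj q\<rangle> - \<kappa> \<bar>p\<bar>\<^sup>2 - \<kappa>' \<bar>q\<bar>\<^sup>2 = 2 \<Delta> \<langle>u, x cj y\<rangle>\<close> and
  \<open>\<bar>\<xi>\<bar>\<^sup>2 - \<kappa> \<kappa>' = \<Delta> \<bar>u\<bar>\<^sup>2\<close>, where \<open>\<Delta>\<close> is Study's determinant, equal to 1 on all three groups. Hence the
  image of \<open>S_u\<close> has interior \<open>2 \<langle>\<xi>, w\<rangle> - \<kappa> \<bar>w\<bar>\<^sup>2 - \<kappa>' > 0\<close> with discriminant 1, from which bend and
  bend-center are read off by completing the square. Only conjugation is used, so the complex and
  quaternionic cases are treated together.\<close>

section \<open>Bends and bend-centers of normalized quadratic inequalities\<close>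

text \<open>An inclusion of balls forces \<open>dist p q + r \<le> s\<close>: move from
  \<open>p\<close> straight away from \<open>q\<close>. Using both inclusions gives
  \<open>dist p q = 0\<close>. The unit vector \<open>e\<close> excludes the zero space, where all
  balls about \<open>0\<close> coincide.\<close>

lemma inner_sphere_inject:
  assumes V: "subspace V" "p \<in> V" "q \<in> V" "e \<in> V" "norm e = 1" and r: "0 < r" "0 < s"
    and eq: "V \<inter> ball p r = V \<inter> ball q s"
  shows "p = q \<and> r = s"
proof -
  have le: "dist p q + r \<le> s"
    if "p \<in> V" "q \<in> V" "0 < r" and sub: "V \<inter> ball p r \<subseteq> ball q s" for p q :: 'a and r s :: real
  proof -
    \<comment> \<open>\<open>f\<close> is the unit direction pointing from \<open>q\<close> to
      \<open>p\<close>; if the centers agree, any direction in \<open>V\<close> will do.\<close>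
    define f where "f = (if p = q then e else (1 / norm (p - q)) *\<^sub>R (p - q))"
    have f: "f \<in> V" "norm f = 1" "p - q = norm (p - q) *\<^sub>R f"
      using V that by (auto simp: f_def subspace_scale subspace_diff)
    have "dist p q + t < s" if t: "0 < t" "t < r" for t
    proof -
      have "p + t *\<^sub>R f \<in> V \<inter> ball p r"
        using t f \<open>p \<in> V\<close> V by (simp add: dist_norm subspace_add subspace_scale)
      then have "norm (p + t *\<^sub>R f - q) < s" using sub
        by (auto simp: dist_norm norm_minus_commute)
      moreover have "p + t *\<^sub>R f - q = (norm (p - q) + t) *\<^sub>R f"
        using f(3) by (simp add: algebra_simps)
      ultimately show ?thesis using t f by (simp add: dist_norm)
    qed
    then have "t \<le> s - dist p q" if "0 < t" "t < r" for t
      using that by force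
    then have "r \<le> s - dist p q"
      using \<open>0 < r\<close> by (meson dense_le_bounded)
    then show ?thesis by simp
  qed
  have "dist p q + r \<le> s" "dist q p + s \<le> r"
    using le[of p q r s] le[of q p s r] assms by blast+
  then show ?thesis
    by (smt (verit) dist_commute zero_le_dist zero_less_dist_iff)
qed

lemma outer_sphere_inject:
  assumes V: "subspace V" "p \<in> V" "q \<in> V" "e \<in> V" "norm e = 1" and r: "0 < r" "0 < s"
    and eq: "V \<inter> sphere p r = V \<inter> sphere q s" "V - cball p r = V - cball q s"
  shows "p = q \<and> r = s"
proof (rule inner_sphere_inject[OF V r])
  have "V \<inter> ball x t = V - (V - cball x t) - V \<inter> sphere x t" for x t
    by auto
  then show "V \<inter> ball p r = V \<inter> ball q s"
    using eq by presburger
qed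

text \<open>If \<open>m \<noteq> n\<close>, a point far out in direction \<open>m - n\<close> lies
  in the first half-space but not in the second, whatever the offsets.\<close>

lemma hyperplane_normal_inject:
  assumes V: "subspace V" "m \<in> V" "n \<in> V" "norm m = 1" "norm n = 1"
    and eq: "{z \<in> V. inner m z > s} = {z \<in> V. inner n z > t}"
  shows "m = n"
proof (rule ccontr)
  assume "m \<noteq> n"
  have 1: "inner m m = 1" "inner n n = 1" using V by (simp_all add: norm_eq_1)
  have pos: "0 < 1 - inner m n"
  proof -
    have "0 < inner (m - n) (m - n)" using \<open>m \<noteq> n\<close> by simp
    then show ?thesis using 1 by (simp add: inner_diff inner_commute)
  qed
  \<comment> \<open>Chosen so that \<open>k *\<^sub>R (m - n)\<close> has inner products
    \<open>\<plusminus>(\<bar>s\<bar> + \<bar>t\<bar> + 1)\<close> with \<open>m\<close> and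
    \<open>n\<close>, which beats both offsets.\<close>
  define k where "k = (\<bar>s\<bar> + \<bar>t\<bar> + 1) / (1 - inner m n)"
  have k: "k * (1 - inner m n) = \<bar>s\<bar> + \<bar>t\<bar> + 1" using pos by (simp add: k_def)
  have mn: "inner m (k *\<^sub>R (m - n)) = k * (1 - inner m n)"
    "inner n (k *\<^sub>R (m - n)) = - (k * (1 - inner m n))"
    using 1 by (simp_all add: inner_diff inner_commute algebra_simps)
  have "k *\<^sub>R (m - n) \<in> {z \<in> V. inner m z > s}"
    unfolding mem_Collect_eq mn k using V by (auto simp: subspace_scale subspace_diff)
  then show False
    unfolding eq mem_Collect_eq mn k by auto
qed

lemma Some_image_eq_iff [simp]: "Some ` A = Some ` B \<longleftrightarrow> A = B"
  by (simp add: inj_image_eq_iff)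

text \<open>The position of \<open>None\<close> separates the three kinds: outside both components,
  in the interior, or on the point set.\<close>

lemma osphere_cases_disjoint [simp]:
  "inner_sphere V p r \<noteq> outer_sphere V' p' r'"
  "inner_sphere V p r \<noteq> hyperplane V' n t"
  "outer_sphere V p r \<noteq> hyperplane V' n t"
  "outer_sphere V p r \<noteq> inner_sphere V' p' r'"
  "hyperplane V' n t \<noteq> inner_sphere V p r"
  "hyperplane V' n t \<noteq> outer_sphere V p r"
  by (auto simp: inner_sphere_def outer_sphere_def hyperplane_def)

lemma inner_sphere_eq_iff:
  assumes "subspace V" "p \<in> V" "q \<in> V" "e \<in> V" "norm e = 1" "0 < r" "0 < s"
  shows "inner_sphere V p r = inner_sphere V q s \<longleftrightarrow> p = q \<and> r = s"
  using inner_sphere_inject[OF assms] by (auto simp: inner_sphere_def)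

lemma outer_sphere_eq_iff:
  assumes "subspace V" "p \<in> V" "q \<in> V" "e \<in> V" "norm e = 1" "0 < r" "0 < s"
  shows "outer_sphere V p r = outer_sphere V q s \<longleftrightarrow> p = q \<and> r = s"
proof
  assume *: "outer_sphere V p r = outer_sphere V q s"
  have "Some ` (V - cball p r) = Some ` (V - cball q s)"
    using * unfolding outer_sphere_def by (simp add: insert_ident)
  then show "p = q \<and> r = s"
    using outer_sphere_inject[OF assms] * by (simp add: outer_sphere_def)
qed auto

lemma bend_inner_sphere:
  assumes "subspace V" "p \<in> V" "e \<in> V" "norm e = 1" "0 < r"
  shows "bend V (inner_sphere V p r) = 1 / r"
    and "bend_center V (inner_sphere V p r) = (1 / r) *\<^sub>R p"
proof -
  show b: "bend V (inner_sphere V p r) = 1 / r"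
    unfolding bend_def using assms by (intro the_equality) (auto simp: inner_sphere_eq_iff)
  show "bend_center V (inner_sphere V p r) = (1 / r) *\<^sub>R p"
    unfolding bend_center_def b using assms by (intro the_equality) (auto simp: inner_sphere_eq_iff)
qed

lemma bend_outer_sphere:
  assumes "subspace V" "p \<in> V" "e \<in> V" "norm e = 1" "0 < r"
  shows "bend V (outer_sphere V p r) = - 1 / r"
    and "bend_center V (outer_sphere V p r) = (- 1 / r) *\<^sub>R p"
proof -
  show b: "bend V (outer_sphere V p r) = - 1 / r"
    unfolding bend_def using assms by (intro the_equality) (auto simp: outer_sphere_eq_iff)
  show "bend_center V (outer_sphere V p r) = (- 1 / r) *\<^sub>R p"
    unfolding bend_center_def b using assms by (intro the_equality) (auto simp: outer_sphere_eq_iff)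
qed

lemma bend_hyperplane:
  assumes "subspace V" "n \<in> V" "norm n = 1"
  shows "bend V (hyperplane V n t) = 0"
    and "bend_center V (hyperplane V n t) = n"
proof -
  show "bend V (hyperplane V n t) = 0"
    unfolding bend_def using assms by (intro the_equality) auto
  have "m = n" if "m \<in> V" "norm m = 1" "hyperplane V n t = hyperplane V m s" for m s
    using hyperplane_normal_inject[of V n m t s] that assms by (auto simp: hyperplane_def)
  then show "bend_center V (hyperplane V n t) = n"
    unfolding bend_center_def using assms by (intro the_equality) auto
qed

text \<open>The value at infinity is the leading coefficient, so that the sign is that of the associated
  homogeneous Hermitian form.\<close>

definition quadratic_side :: "real \<Rightarrow> real \<Rightarrow> 'a::real_inner \<Rightarrow> 'a option \<Rightarrow> real"
  where "quadratic_side k k' x w =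
    (case w of None \<Rightarrow> - k | Some z \<Rightarrow> 2 * inner x z - k * (norm z)\<^sup>2 - k')"

abbreviation extended :: "'a set \<Rightarrow> 'a option set"
  where "extended V \<equiv> insert None (Some ` V)"

text \<open>By completing the square, \<open>k\<close> times the quadratic expression is
  \<open>1 - (norm (x - k *\<^sub>R z))\<^sup>2\<close>; the discriminant makes the radius
  \<open>1 / \<bar>k\<bar>\<close> and the center \<open>x / k\<close>.\<close>

lemma bend_of_quadratic_side:
  fixes x :: "'a::real_inner"
  assumes V: "subspace V" "x \<in> V" "e \<in> V" "norm e = 1" and disc: "(norm x)\<^sup>2 - k * k' = 1"
    and S: "S = ({w \<in> extended V. quadratic_side k k' x w = 0}, {w \<in> extended V. quadratic_side k k' x w > 0})"
  shows "bend V S = k" and "bend_center V S = x"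
proof -
  have sq: "k * (2 * inner x z - k * (norm z)\<^sup>2 - k') = 1 - (k * dist ((1/k) *\<^sub>R x) z)\<^sup>2" if "k \<noteq> 0" for z
  proof -
    have "(k * dist ((1/k) *\<^sub>R x) z)\<^sup>2 = (norm (k *\<^sub>R ((1/k) *\<^sub>R x - z)))\<^sup>2"
      by (simp add: dist_norm power_mult_distrib)
    also have "\<dots> = (norm (x - k *\<^sub>R z))\<^sup>2"
      using that by (simp add: scaleR_diff_right)
    also have "\<dots> = (norm x)\<^sup>2 - 2 * k * inner x z + k\<^sup>2 * (norm z)\<^sup>2"
      unfolding power2_norm_eq_inner by (simp add: inner_diff inner_commute algebra_simps power2_eq_square[of k])
    finally show ?thesis using disc by (simp add: algebra_simps power2_eq_square)
  qed
  consider "k > 0" | "k < 0" | "k = 0" by linarith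
  then have "bend V S = k \<and> bend_center V S = x"
  proof cases
    case 1
    have z: "2 * inner x z - k * (norm z)\<^sup>2 - k' = 0 \<longleftrightarrow> dist ((1/k) *\<^sub>R x) z = 1/k"
      "2 * inner x z - k * (norm z)\<^sup>2 - k' > 0 \<longleftrightarrow> dist ((1/k) *\<^sub>R x) z < 1/k" for z
    proof -
      have "2 * inner x z - k * (norm z)\<^sup>2 - k' = 0 \<longleftrightarrow> k * dist ((1/k) *\<^sub>R x) z = 1"
        using sq[of z] 1 by (smt (verit) mult_nonneg_nonneg power2_eq_1_iff mult_eq_0_iff zero_le_dist)
      then show "2 * inner x z - k * (norm z)\<^sup>2 - k' = 0 \<longleftrightarrow> dist ((1/k) *\<^sub>R x) z = 1/k"
        using 1 by (simp add: field_simps)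
      have "2 * inner x z - k * (norm z)\<^sup>2 - k' > 0 \<longleftrightarrow> (k * dist ((1/k) *\<^sub>R x) z)\<^sup>2 < 1"
        using sq[of z] 1 by (smt (verit) zero_less_mult_pos zero_less_mult_iff)
      also have "\<dots> \<longleftrightarrow> k * dist ((1/k) *\<^sub>R x) z < 1"
        using 1 by (simp add: abs_square_less_1)
      finally show "2 * inner x z - k * (norm z)\<^sup>2 - k' > 0 \<longleftrightarrow> dist ((1/k) *\<^sub>R x) z < 1/k"
        using 1 by (simp add: field_simps)
    qed
    have "S = inner_sphere V ((1/k) *\<^sub>R x) (1/k)"
      unfolding S inner_sphere_def quadratic_side_def using z 1 by auto
    then show ?thesis
      using bend_inner_sphere[OF V(1) _ V(3,4), of "(1/k) *\<^sub>R x" "1/k"] V 1 by (simp add: subspace_scale)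
  next
    \<comment> \<open>Dividing by the negative \<open>k\<close> reverses the inequality, so the
      positive side is the exterior; it contains infinity, where the value is
      \<open>- k > 0\<close>.\<close>
    case 2
    have z: "2 * inner x z - k * (norm z)\<^sup>2 - k' = 0 \<longleftrightarrow> dist ((1/k) *\<^sub>R x) z = -1/k"
      "2 * inner x z - k * (norm z)\<^sup>2 - k' > 0 \<longleftrightarrow> dist ((1/k) *\<^sub>R x) z > -1/k" for z
    proof -
      have "2 * inner x z - k * (norm z)\<^sup>2 - k' = 0 \<longleftrightarrow> (-k) * dist ((1/k) *\<^sub>R x) z = 1"
        using sq[of z] 2 by (smt (verit) mult_nonneg_nonneg power2_eq_1_iff mult_eq_0_iff zero_le_dist mult_minus_left power2_minus)
      then show "2 * inner x z - k * (norm z)\<^sup>2 - k' = 0 \<longleftrightarrow> dist ((1/k) *\<^sub>R x) z = -1/k"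
        using 2 by (auto simp add: field_simps)
      have "2 * inner x z - k * (norm z)\<^sup>2 - k' > 0 \<longleftrightarrow> ((-k) * dist ((1/k) *\<^sub>R x) z)\<^sup>2 > 1"
        using sq[of z] 2 mult_less_0_iff[of k "2 * inner x z - k * (norm z)\<^sup>2 - k'"] by auto
      also have "\<dots> \<longleftrightarrow> (-k) * dist ((1/k) *\<^sub>R x) z > 1"
        using 2 power2_less_imp_less[of 1 "(-k) * dist ((1/k) *\<^sub>R x) z"]
         power_strict_mono[of 1 "(-k) * dist ((1/k) *\<^sub>R x) z" 2]
        by (auto simp: mult_nonneg_nonneg mult_nonpos_nonneg)
      finally show "2 * inner x z - k * (norm z)\<^sup>2 - k' > 0 \<longleftrightarrow> dist ((1/k) *\<^sub>R x) z > -1/k"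
        using 2 by (auto simp add: field_simps)
    qed
    have "S = outer_sphere V ((1/k) *\<^sub>R x) (-1/k)"
      unfolding S outer_sphere_def quadratic_side_def using z 2 by (auto simp: not_le)
    then show ?thesis
      using bend_outer_sphere[OF V(1) _ V(3,4), of "(1/k) *\<^sub>R x" "-1/k"] V 2 by (simp add: subspace_scale)
  next
    case 3
    have "S = hyperplane V x (k'/2)"
      unfolding S hyperplane_def quadratic_side_def using 3 by auto
    moreover have "norm x = 1"
      using disc 3 power2_eq_1_iff[of "norm x"] norm_ge_zero[of x] by auto
    ultimately show ?thesis
      using bend_hyperplane[OF V(1,2)] 3 by simp
  qed
  then show "bend V S = k" "bend_center V S = x" by auto
qed

section \<open>Division algebras with conjugation\<close>

text \<open>Both \<open>cnj\<close> and \<open>qcnj\<close> satisfy these axioms. Linearity,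
  involutivity and invariance of the inner product follow via \<open>cj_eq\<close>, which says that
  \<open>cj\<close> is the reflection in the real line.\<close>

locale conj_algebra =
  fixes cj :: "'a::{real_normed_div_algebra,real_inner} \<Rightarrow> 'a"
  assumes cj_add [simp]: "cj (x + y) = cj x + cj y"
    and cj_mult [simp]: "cj (x * y) = cj y * cj x"
    and mult_cj: "x * cj x = of_real ((norm x)\<^sup>2)"
begin

abbreviation re :: "'a \<Rightarrow> real"
  where "re \<equiv> inner 1"

lemma inner_one [simp]: "inner (1::'a) 1 = 1"
  by (simp flip: power2_norm_eq_inner)

lemma cj_one [simp]: "cj 1 = 1"
  using mult_cj[of 1] by simp

text \<open>Polarization of the norm axiom at \<open>1 + x\<close>.\<close>

lemma add_cj: "x + cj x = of_real (2 * re x)"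
proof -
  have "(1 + x) * cj (1 + x) = of_real ((norm (1 + x))\<^sup>2)" by (rule mult_cj)
  moreover have "(norm (1 + x))\<^sup>2 = 1 + 2 * re x + (norm x)\<^sup>2"
    by (simp add: power2_norm_eq_inner inner_add inner_commute)
  ultimately show ?thesis using mult_cj[of x] by (simp add: algebra_simps)
qed

lemma cj_eq: "cj x = (2 * re x) *\<^sub>R 1 - x"
  using add_cj[of x] by (simp add: of_real_def algebra_simps)

lemma cj_linear [simp]:
  "cj (r *\<^sub>R x) = r *\<^sub>R cj x" "cj (- x) = - cj x" "cj (x - y) = cj x - cj y" "cj 0 = 0"
  by (simp_all add: cj_eq inner_diff algebra_simps)

lemma cj_of_real [simp]: "cj (of_real r) = of_real r"
  by (simp add: of_real_def)

lemma re_cj [simp]: "re (cj x) = re x"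
  by (simp add: cj_eq inner_diff)

lemma cj_cj [simp]: "cj (cj x) = x"
  by (subst cj_eq, simp, simp add: cj_eq)

lemma inner_cj_cj [simp]: "inner (cj x) (cj y) = inner x y"
  by (simp add: cj_eq inner_diff inner_commute)

lemma norm_cj [simp]: "norm (cj x) = norm x"
  by (simp add: norm_eq_sqrt_inner)

lemma cj_mult_self: "cj x * x = of_real ((norm x)\<^sup>2)"
  using mult_cj[of "cj x"] by simp

lemma mult_cj_assoc: "x * (cj x * y) = (norm x)\<^sup>2 *\<^sub>R y" "cj x * (x * y) = (norm x)\<^sup>2 *\<^sub>R y"
  by (simp_all only: mult.assoc[symmetric] mult_cj cj_mult_self of_real_def) simp_all

lemmas cj_cancel = mult_cj_assoc mult_cj[unfolded of_real_def] cj_mult_self[unfolded of_real_def]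

lemma re_mult_cj: "re (x * cj y) = inner x y"
proof -
  have "x * cj y + cj (x * cj y) = (x + y) * cj (x + y) - x * cj x - y * cj y"
    by (simp add: algebra_simps)
  also have "\<dots> = of_real (2 * inner x y)"
    unfolding mult_cj by (simp add: power2_norm_eq_inner inner_add inner_commute)
  finally show ?thesis unfolding add_cj by (simp only: of_real_eq_iff)
qed

text \<open>Cyclicity of the real part, the substitute for commutativity below. Both sides are inner
  products, and \<open>cj\<close> is an isometry.\<close>

lemma re_mult_commute: "re (x * y) = re (y * x)"
  using re_mult_cj[of x "cj y"] re_mult_cj[of y "cj x"] inner_cj_cj[of x "cj y"]
  by (simp add: inner_commute)

text \<open>Study's determinant: over the quaternions it equals the determinant of the associated complex
  \<open>4 \<times> 4\<close> matrix, over the complex numbers it is \<open>\<bar>a d - b c\<bar>\<^sup>2\<close>.\<close>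

definition ndet :: "'a \<Rightarrow> 'a \<Rightarrow> 'a \<Rightarrow> 'a \<Rightarrow> real"
  where "ndet a b c d = (norm a)\<^sup>2 * (norm d)\<^sup>2 + (norm b)\<^sup>2 * (norm c)\<^sup>2 - 2 * re (cj c * d * cj b * a)"

text \<open>One half of the vector \<open>T\<close> in \<open>form_pullback\<close>; the other
  arises by exchanging the two rows. The cross term \<open>w + cj w\<close> of
  \<open>(norm p)\<^sup>2\<close> is real, so it may be written to the right of \<open>c\<close>,
  where \<open>c * w\<close> cancels a term of \<open>q * cj p * a\<close>.\<close>

lemma kernel_half:
  assumes "p = a * x + b * y" "q = c * x + d * y"
  shows "q * cj p * a - (norm p)\<^sup>2 *\<^sub>R c =
    ((norm a)\<^sup>2 *\<^sub>R d - c * cj a * b) * (y * cj x) + (norm y)\<^sup>2 *\<^sub>R (d * cj b * a - (norm b)\<^sup>2 *\<^sub>R c)"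
proof -
  define w where "w = x * cj y * cj b * a"
  have "2 * inner (a * x) (b * y) = 2 * re w"
    using re_mult_commute[of a "x * cj y * cj b"] re_mult_cj[of "a * x" "b * y"]
    by (simp add: w_def mult.assoc)
  then have "(norm p)\<^sup>2 = (norm a)\<^sup>2 * (norm x)\<^sup>2 + (norm b)\<^sup>2 * (norm y)\<^sup>2 + 2 * re w"
    unfolding assms
    by (simp add: power2_norm_eq_inner inner_add inner_commute)
      (simp add: power2_norm_eq_inner[symmetric] norm_mult power_mult_distrib)
  then have "(norm p)\<^sup>2 *\<^sub>R c = ((norm a)\<^sup>2 * (norm x)\<^sup>2 + (norm b)\<^sup>2 * (norm y)\<^sup>2) *\<^sub>R c + c * (w + cj w)"
    unfolding add_cj by (simp add: of_real_def scaleR_add_left)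
  then show ?thesis
    by (simp add: assms w_def algebra_simps cj_cancel)
qed

lemma re_rotate4: "re (a * u * s * t) = re (u * (s * t * a))"
  using re_mult_commute[of a "u * (s * t)"] by (simp add: mult.assoc)

text \<open>\<open>sbend c d u\<close> is the asserted bend and \<open>sbend a b u\<close> the
  asserted co-bend, taken as real numbers so that they can be coefficients of a real quadratic
  form.\<close>

definition sbend :: "'a \<Rightarrow> 'a \<Rightarrow> 'a \<Rightarrow> real"
  where "sbend c d u = 2 * re (c * u * cj d)"

definition scenter :: "'a \<Rightarrow> 'a \<Rightarrow> 'a \<Rightarrow> 'a \<Rightarrow> 'a \<Rightarrow> 'a"
  where "scenter a b c d u = a * u * cj d + b * cj u * cj c"

lemma of_real_sbend: "of_real (sbend c d u) = c * u * cj d + d * cj u * cj c"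
  unfolding sbend_def add_cj[symmetric] by (simp add: mult.assoc)

text \<open>Cyclicity of \<open>re\<close> isolates \<open>u\<close>: the left side is
  \<open>2 * re (u * T)\<close>, where \<open>T\<close> is a real multiple of
  \<open>y * cj x\<close>.\<close>

lemma form_pullback:
  assumes p: "p = a * x + b * y" and q: "q = c * x + d * y"
  shows "2 * inner (scenter a b c d u) (p * cj q) - sbend c d u * (norm p)\<^sup>2 - sbend a b u * (norm q)\<^sup>2
    = 2 * ndet a b c d * inner u (x * cj y)"
proof -
  have 1: "re (c * u * cj d) = re (u * (cj d * c))" "re (a * u * cj b) = re (u * (cj b * a))"
    "re (a * u * cj d * (q * cj p)) = re (u * (cj d * (q * cj p * a)))"
    using re_rotate4[of c u "cj d" 1] re_rotate4[of a u "cj b" 1] re_rotate4[of a u "cj d" "q * cj p"]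
    by (simp_all add: mult.assoc)
  \<comment> \<open>This term contains \<open>cj u\<close>; conjugating inside \<open>re\<close>
    turns it into \<open>u\<close>.\<close>
  have 2: "re (b * cj u * cj c * (q * cj p)) = re (u * (cj b * (p * cj q * c)))"
  proof -
    have "re (b * cj u * cj c * (q * cj p)) = re (cj (b * cj u * cj c * (q * cj p)))"
      by (rule re_cj[symmetric])
    also have "\<dots> = re (p * cj q * c * u * cj b)" by (simp add: mult.assoc)
    also have "\<dots> = re (u * (cj b * (p * cj q * c)))"
      using re_rotate4[of "p * cj q * c" u "cj b" 1] by (simp add: mult.assoc)
    finally show ?thesis .
  qed
  define T where "T = cj d * (q * cj p * a - (norm p)\<^sup>2 *\<^sub>R c) + cj b * (p * cj q * c - (norm q)\<^sup>2 *\<^sub>R a)"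
  have "inner (scenter a b c d u) (p * cj q)
     = re (u * (cj d * (q * cj p * a))) + re (u * (cj b * (p * cj q * c)))"
    unfolding 1[symmetric] 2[symmetric] using re_mult_cj[of "scenter a b c d u" "p * cj q"]
    by (simp add: scenter_def distrib_right inner_add)
  then have "2 * inner (scenter a b c d u) (p * cj q) - sbend c d u * (norm p)\<^sup>2 - sbend a b u * (norm q)\<^sup>2
    = 2 * re (u * T)"
    unfolding sbend_def 1 by (simp add: T_def algebra_simps inner_add inner_diff)
  also have "T = ndet a b c d *\<^sub>R (y * cj x)"
  proof -
    \<comment> \<open>In \<open>T\<close> the terms with \<open>(norm y)\<^sup>2\<close> from the
      two halves cancel, and the mixed terms add up to the real number
      \<open>w + cj w\<close>.\<close>
    define w where "w = cj b * a * cj c * d"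
    have w: "re (cj c * d * cj b * a) = re w"
      using re_mult_commute[of "cj c * d" "cj b * a"] by (simp add: w_def mult.assoc)
    have "T = ((norm a)\<^sup>2 * (norm d)\<^sup>2 + (norm b)\<^sup>2 * (norm c)\<^sup>2) *\<^sub>R (y * cj x) - (w + cj w) * (y * cj x)"
      unfolding T_def kernel_half[OF p q] kernel_half[OF q p]
      by (simp add: w_def algebra_simps cj_cancel)
    then show ?thesis
      unfolding add_cj ndet_def w by (simp add: of_real_def algebra_simps)
  qed
  also have "2 * re (u * (ndet a b c d *\<^sub>R (y * cj x))) = 2 * ndet a b c d * inner u (x * cj y)"
    using re_mult_cj[of u "x * cj y"] by simp
  finally show ?thesis .
qed

text \<open>With \<open>P = cj d * c\<close> and \<open>Q = cj b * a\<close> the cross term is \<open>re (u P u Q)\<close>, and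
  \<open>u P u = 2 re (u P) u - \<bar>u\<bar>\<^sup>2 cj P\<close>.\<close>

lemma discriminant:
  "(norm (scenter a b c d u))\<^sup>2 - sbend c d u * sbend a b u = ndet a b c d * (norm u)\<^sup>2"
proof -
  define P Q where "P = cj d * c" and "Q = cj b * a"
  have k: "re (c * u * cj d) = re (u * P)" "re (a * u * cj b) = re (u * Q)"
    using re_rotate4[of c u "cj d" 1] re_rotate4[of a u "cj b" 1] by (simp_all add: P_def Q_def)
  have "inner (a * u * cj d) (b * cj u * cj c) = re (a * u * (cj d * c * u) * cj b)"
    using re_mult_cj[of "a * u * cj d" "b * cj u * cj c"] by (simp add: mult.assoc)
  also have "\<dots> = re (u * P * u * Q)"
    unfolding re_rotate4[of a u "cj d * c * u" "cj b"] by (simp add: P_def Q_def mult.assoc)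
  finally have i: "inner (a * u * cj d) (b * cj u * cj c) = re (u * P * u * Q)" .
  have "u * P * u = (u * P + cj (u * P)) * u - cj P * cj u * u"
    by (simp add: algebra_simps)
  then have "u * P * u = (2 * re (u * P)) *\<^sub>R u - (norm u)\<^sup>2 *\<^sub>R cj P"
    unfolding add_cj by (simp add: mult.assoc of_real_def cj_cancel)
  then have "u * P * u * Q = (2 * re (u * P)) *\<^sub>R (u * Q) - (norm u)\<^sup>2 *\<^sub>R (cj P * Q)"
    by (simp add: left_diff_distrib)
  then have "re (u * P * u * Q) = 2 * re (u * P) * re (u * Q) - (norm u)\<^sup>2 * re (cj P * Q)"
    by (simp add: inner_diff)
  then show ?thesis
    unfolding scenter_def sbend_def k
    by (simp add: power2_norm_eq_inner inner_add inner_commute i)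
      (simp add: power2_norm_eq_inner[symmetric] norm_mult power_mult_distrib ndet_def P_def Q_def algebra_simps)
qed

text \<open>Rows that are left-dependent, or columns that are right-dependent as in the next lemma,
  make Study's determinant vanish. These are the two sides on which scalars factor out.\<close>

lemma ndet_zero_if_left:
  "ndet (w * c) (w * d) c d = 0"
proof -
  have "re (cj c * d * cj (w * d) * (w * c)) = (norm w)\<^sup>2 * (norm d)\<^sup>2 * (norm c)\<^sup>2"
    by (simp add: mult.assoc cj_cancel)
  then show ?thesis by (simp add: ndet_def norm_mult power_mult_distrib)
qed

lemma ndet_zero_if_right: "ndet a (a * z) c (c * z) = 0"
proof -
  have "re (cj c * (c * z) * cj (a * z) * a) = (norm z)\<^sup>2 * (norm a)\<^sup>2 * (norm c)\<^sup>2"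
    by (simp add: mult.assoc cj_cancel)
  then show ?thesis by (simp add: ndet_def norm_mult power_mult_distrib)
qed

lemma ndet_rows_swap: "ndet (- c) (- d) a b = ndet a b c d"
proof -
  have "re (cj a * b * cj d * c) = re (cj (cj a * b * cj d * c))" by (rule re_cj[symmetric])
  also have "\<dots> = re (cj c * d * cj b * a)" by (simp add: mult.assoc)
  finally show ?thesis by (simp add: ndet_def)
qed

end

section \<open>The image of a hyperplane through the origin\<close>

text \<open>Homogeneous coordinates on the projective line: matrices act on the left, so common
  scalars cancel on the right. The pair \<open>(0, 0)\<close> gets the default value
  \<open>None\<close> and is excluded where it matters.\<close>

definition hom_point :: "'a::division_ring \<Rightarrow> 'a \<Rightarrow> 'a option"
  where "hom_point x y = (if y = 0 then None else Some (x * inverse y))"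

lemma hom_point_cases:
  obtains x y where "(x, y) \<noteq> (0, 0)" "w = hom_point x y"
proof (cases w)
  case None
  then show ?thesis using that[of 1 0] by (simp add: hom_point_def)
next
  case (Some z)
  then show ?thesis using that[of z 1] by (simp add: hom_point_def)
qed

lemma mat2_sel [simp]:
  "mat2 a b c d $ 1 $ 1 = a" "mat2 a b c d $ 1 $ 2 = b"
  "mat2 a b c d $ 2 $ 1 = c" "mat2 a b c d $ 2 $ 2 = d"
  by (simp_all add: mat2_def)

lemma moebius_hom_point:
  assumes "(x, y) \<noteq> (0, 0)"
  shows "moebius (mat2 a b c d) (hom_point x y) = hom_point (a * x + b * y) (c * x + d * y)"
proof (cases "y = 0")
  case True
  then have "a * x * inverse (c * x) = a * inverse c" if "c \<noteq> 0"
    using assms that by (simp add: nonzero_inverse_mult_distrib mult.assoc[symmetric])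
      (simp add: mult.assoc)
  then show ?thesis using True assms by (simp add: hom_point_def)
next
  case False
  have *: "e * (x * inverse y) + f = (e * x + f * y) * inverse y" for e f
    using False by (simp add: distrib_right mult.assoc)
  have "(a * x + b * y) * inverse y * inverse ((c * x + d * y) * inverse y) =
    (a * x + b * y) * inverse (c * x + d * y)" if "c * x + d * y \<noteq> 0"
    using that False by (simp add: nonzero_inverse_mult_distrib mult.assoc)
      (simp add: mult.assoc[symmetric])
  then show ?thesis using False by (simp add: hom_point_def *)
qed

text \<open>A nonzero left-linear equation determines the ratio \<open>x * inverse y\<close>, so it
  has exactly one solution on the projective line.\<close>

lemma hom_point_line:
  assumes "(\<alpha>, \<beta>) \<noteq> (0, 0 :: 'a::division_ring)"
  obtains v where "\<And>x y. (x, y) \<noteq> (0, 0) \<Longrightarrow> \<alpha> * x = \<beta> * y \<longleftrightarrow> hom_point x y = v"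
proof (cases "\<alpha> = 0")
  case True
  then show ?thesis using that[of None] assms by (simp add: hom_point_def)
next
  case False
  have "\<alpha> * x = \<beta> * y \<longleftrightarrow> hom_point x y = Some (inverse \<alpha> * \<beta>)" if "(x, y) \<noteq> (0, 0)" for x y
  proof (cases "y = 0")
    case True
    then show ?thesis using False that by (simp add: hom_point_def)
  next
    case y: False
    have "\<alpha> * x = \<beta> * y \<longleftrightarrow> x = inverse \<alpha> * \<beta> * y"
      using False by (metis left_inverse mult.assoc mult_1_left right_inverse)
    also have "\<dots> \<longleftrightarrow> x * inverse y = inverse \<alpha> * \<beta>"
      using y by (metis left_inverse mult.assoc mult_1_right right_inverse)
    finally show ?thesis using y by (simp add: hom_point_def)
  qed
  then show ?thesis using that by blast
qed

lemma S_u_quadratic_side: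
  "S_u V u = ({w \<in> extended V. quadratic_side 0 0 u w = 0}, {w \<in> extended V. quadratic_side 0 0 u w > 0})"
  by (auto simp: hyperplane_def quadratic_side_def)

section \<open>Moebius maps as bijections and their effect on quadratic sides\<close>

context conj_algebra
begin

text \<open>A kernel vector with \<open>y \<noteq> 0\<close> would make the second column a right
  multiple of the first; one with \<open>y = 0\<close> would force \<open>a = c = 0\<close>.\<close>

lemma mat2_kernel:
  assumes "ndet a b c d \<noteq> 0" "(x, y) \<noteq> (0, 0)"
  shows "(a * x + b * y, c * x + d * y) \<noteq> (0, 0)"
proof
  assume 0: "(a * x + b * y, c * x + d * y) = (0, 0)"
  show False
  proof (cases "y = 0")
    case True
    then show False using 0 assms by (auto simp: ndet_def)
  next
    case False
    have *: "f = e * (- x * inverse y)" if "e * x + f * y = 0" for e f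
    proof -
      have "(e * x + f * y) * inverse y = 0" using that by simp
      then show ?thesis using False by (simp add: distrib_right mult.assoc add_eq_0_iff)
    qed
    show False
      using assms(1) ndet_zero_if_right[of a "- x * inverse y" c] *[of a b] *[of c d] 0 by simp
  qed
qed

text \<open>In homogeneous coordinates each fibre is a nonzero left-linear equation, hence a single
  point. This gives injectivity and surjectivity at once, without an inverse matrix.\<close>

lemma moebius_fibre:
  assumes nd: "ndet a b c d \<noteq> 0"
  shows "\<exists>v. \<forall>z. moebius (mat2 a b c d) z = w \<longleftrightarrow> z = v"
proof -
  obtain \<alpha> \<beta> where \<alpha>\<beta>: "(\<alpha>, \<beta>) \<noteq> (0, 0)"
    and *: "\<And>x y. (x, y) \<noteq> (0, 0) \<Longrightarrow> moebius (mat2 a b c d) (hom_point x y) = w \<longleftrightarrow> \<alpha> * x = \<beta> * y"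
  proof (cases w)
    case None
    have "(c, - d) \<noteq> (0, 0)" using nd by (auto simp: ndet_def)
    moreover have "moebius (mat2 a b c d) (hom_point x y) = w \<longleftrightarrow> c * x = (- d) * y"
      if "(x, y) \<noteq> (0, 0)" for x y
      unfolding moebius_hom_point[OF that] unfolding None hom_point_def by (simp add: eq_neg_iff_add_eq_0)
    ultimately show ?thesis by (rule that)
  next
    case (Some p)
    \<comment> \<open>If both coefficients vanished, the first row would be \<open>p\<close> times
      the second.\<close>
    have "(a - p * c, p * d - b) \<noteq> (0, 0)" using nd ndet_zero_if_left[of p c d] by auto
    moreover have "moebius (mat2 a b c d) (hom_point x y) = w \<longleftrightarrow> (a - p * c) * x = (p * d - b) * y"
      if "(x, y) \<noteq> (0, 0)" for x y
    proof -
      let ?P = "a * x + b * y" and ?Q = "c * x + d * y"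
      have ne: "(?P, ?Q) \<noteq> (0, 0)" using mat2_kernel[OF nd that] .
      have "moebius (mat2 a b c d) (hom_point x y) = w \<longleftrightarrow> ?Q \<noteq> 0 \<and> ?P * inverse ?Q = p"
        unfolding moebius_hom_point[OF that] unfolding Some hom_point_def by simp
      also have "\<dots> \<longleftrightarrow> ?P = p * ?Q"
        using ne by (cases "?Q = 0") (auto simp: mult.assoc)
      also have "\<dots> \<longleftrightarrow> (a - p * c) * x = (p * d - b) * y"
        by (auto simp: algebra_simps)
      finally show ?thesis .
    qed
    ultimately show ?thesis by (rule that)
  qed
  obtain v where v: "\<And>x y. (x, y) \<noteq> (0, 0) \<Longrightarrow> \<alpha> * x = \<beta> * y \<longleftrightarrow> hom_point x y = v"
    using hom_point_line[OF \<alpha>\<beta>] by blast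
  have "moebius (mat2 a b c d) z = w \<longleftrightarrow> z = v" for z
    by (rule hom_point_cases[of z]) (simp add: * v)
  then show ?thesis by blast
qed

lemma bij_moebius:
  assumes "ndet a b c d \<noteq> 0"
  shows "bij (moebius (mat2 a b c d))"
  unfolding bij_iff using moebius_fibre[OF assms] by metis

lemma moebius_UNIV:
  assumes "ndet a b c d \<noteq> 0"
  shows "moebius (mat2 a b c d) ` extended UNIV = extended UNIV"
  using bij_moebius[OF assms] by (simp only: UNIV_option_conv[symmetric] bij_is_surj)

lemma moebius_neg_inverse:
  assumes "ndet a b c d \<noteq> 0"
  shows "moebius (mat2 0 (- 1) 1 0) (moebius (mat2 a b c d) w) = moebius (mat2 (- c) (- d) a b) w"
proof -
  obtain x y where xy: "(x, y) \<noteq> (0, 0)" "w = hom_point x y" by (rule hom_point_cases)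
  have *: "0 * (a * x + b * y) + - 1 * (c * x + d * y) = - c * x + - d * y"
    "1 * (a * x + b * y) + 0 * (c * x + d * y) = a * x + b * y"
    by (simp_all add: algebra_simps)
  show ?thesis
    unfolding xy(2) moebius_hom_point[OF xy(1)] moebius_hom_point[OF mat2_kernel[OF assms xy(1)]] *
    ..
qed

text \<open>Dehomogenization through
  \<open>p * cj q = (norm q)\<^sup>2 *\<^sub>R (p * inverse q)\<close>. The factor is positive, so
  the Hermitian form and the affine expression have the same sign, also at infinity.\<close>

lemma quadratic_side_hom_point:
  assumes "(p, q) \<noteq> (0, 0)"
  shows "2 * inner x (p * cj q) - k * (norm p)\<^sup>2 - k' * (norm q)\<^sup>2 =
    (if q = 0 then (norm p)\<^sup>2 else (norm q)\<^sup>2) * quadratic_side k k' x (hom_point p q)"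
proof (cases "q = 0")
  case True
  then show ?thesis by (simp add: quadratic_side_def hom_point_def)
next
  case False
  have "p * inverse q * (q * cj q) = p * cj q"
    using False by (metis left_inverse mult.assoc mult_1_right)
  then have "p * cj q = (norm q)\<^sup>2 *\<^sub>R (p * inverse q)"
    by (simp add: mult_cj of_real_def)
  moreover have "norm p = norm (p * inverse q) * norm q"
    using False by (simp add: norm_mult norm_inverse)
  ultimately show ?thesis
    using False by (simp add: quadratic_side_def hom_point_def power_mult_distrib algebra_simps)
qed

lemma quadratic_side_moebius:
  assumes nd: "ndet a b c d = 1"
  shows "\<exists>r>0. quadratic_side (sbend c d u) (sbend a b u) (scenter a b c d u) (moebius (mat2 a b c d) w)
    = r * quadratic_side 0 0 u w"
proof -
  obtain x y where xy: "(x, y) \<noteq> (0, 0)" "w = hom_point x y" by (rule hom_point_cases)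
  define p q where "p = a * x + b * y" and "q = c * x + d * y"
  have pq: "(p, q) \<noteq> (0, 0)"
    unfolding p_def q_def using mat2_kernel[OF _ xy(1)] nd by (metis zero_neq_one)
  have "moebius (mat2 a b c d) w = hom_point p q"
    using xy by (simp add: moebius_hom_point p_def q_def)
  moreover define r s where "r = (if q = 0 then (norm p)\<^sup>2 else (norm q)\<^sup>2)"
    and "s = (if y = 0 then (norm x)\<^sup>2 else (norm y)\<^sup>2)"
  have "2 * inner (scenter a b c d u) (p * cj q) - sbend c d u * (norm p)\<^sup>2 - sbend a b u * (norm q)\<^sup>2
    = 2 * inner u (x * cj y) - 0 * (norm x)\<^sup>2 - 0 * (norm y)\<^sup>2"
    using form_pullback[OF p_def q_def] nd by simp
  then have "r * quadratic_side (sbend c d u) (sbend a b u) (scenter a b c d u) (hom_point p q)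
    = s * quadratic_side 0 0 u (hom_point x y)"
    unfolding quadratic_side_hom_point[OF pq] quadratic_side_hom_point[OF xy(1)] r_def s_def .
  moreover have "r > 0" "s > 0"
    using pq xy by (auto simp: r_def s_def)
  ultimately show ?thesis
    by (intro exI[of _ "s / r"]) (simp add: xy field_simps)
qed

text \<open>The map is onto \<open>extended V\<close> and preserves the sign of the defining
  functions, so it carries zero set to zero set and positive side to positive side.\<close>

lemma act_S_u:
  fixes a b c d u :: 'a
  assumes nd: "ndet a b c d = 1"
    and V: "moebius (mat2 a b c d) ` extended V = extended V"
  defines "F \<equiv> quadratic_side (sbend c d u) (sbend a b u) (scenter a b c d u)"
  shows "act (mat2 a b c d) (S_u V u) = ({w \<in> extended V. F w = 0}, {w \<in> extended V. F w > 0})"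
proof -
  have F: "F (moebius (mat2 a b c d) w) = 0 \<longleftrightarrow> quadratic_side 0 0 u w = 0"
    "F (moebius (mat2 a b c d) w) > 0 \<longleftrightarrow> quadratic_side 0 0 u w > 0" for w
    using quadratic_side_moebius[OF nd, of u w] by (auto simp: F_def zero_less_mult_iff)
  have "f ` {w \<in> E. P w} = {w \<in> E. Q w}" if "f ` E = E" "\<And>w. Q (f w) \<longleftrightarrow> P w"
    for f :: "'a option \<Rightarrow> 'a option" and E P Q
    using that by force
  from this[OF V, where P = "\<lambda>w. quadratic_side 0 0 u w = 0" and Q = "\<lambda>w. F w = 0"]
    this[OF V, where P = "\<lambda>w. quadratic_side 0 0 u w > 0" and Q = "\<lambda>w. F w > 0"]
  show ?thesis
    unfolding S_u_quadratic_side act_def fst_conv snd_conv using F by presburger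
qed

lemma bend_act_S_u:
  assumes V: "subspace V" "u \<in> V" "norm u = 1" and nd: "ndet a b c d = 1"
    and M: "moebius (mat2 a b c d) ` extended V = extended V" and x: "scenter a b c d u \<in> V"
  shows "bend V (act (mat2 a b c d) (S_u V u)) = sbend c d u"
    and "bend_center V (act (mat2 a b c d) (S_u V u)) = scenter a b c d u"
proof -
  have "(norm (scenter a b c d u))\<^sup>2 - sbend c d u * sbend a b u = 1"
    using discriminant nd V by simp
  \<comment> \<open>\<open>u\<close> itself serves as the unit vector of \<open>V\<close>.\<close>
  note * = bend_of_quadratic_side[OF V(1) x V(2,3) this act_S_u[OF nd M]]
  show "bend V (act (mat2 a b c d) (S_u V u)) = sbend c d u"
    and "bend_center V (act (mat2 a b c d) (S_u V u)) = scenter a b c d u"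
    using * by auto
qed

text \<open>Following the action by negated inversion gives the matrix with rows
  \<open>(- c, - d)\<close> and \<open>(a, b)\<close>, so the co-bend is the bend for the lower row
  \<open>(a, b)\<close>. Its bend-center is minus the conjugate of the original one, so
  \<open>V\<close> must be stable under \<open>cj\<close>.\<close>

lemma bend_cobend_center_act_S_u:
  assumes V: "subspace V" "u \<in> V" "norm u = 1" and inv: "\<And>x. x \<in> V \<Longrightarrow> inverse x \<in> V"
    and nd: "ndet a b c d = 1"
    and M: "moebius (mat2 a b c d) ` extended V = extended V"
    and x: "a * u * cj d + b * cj u * cj c \<in> V"
  shows "of_real (bend V (act (mat2 a b c d) (S_u V u))) = c * u * cj d + d * cj u * cj c \<and>
    of_real (cobend V (act (mat2 a b c d) (S_u V u))) = a * u * cj b + b * cj u * cj a \<and>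
    bend_center V (act (mat2 a b c d) (S_u V u)) = a * u * cj d + b * cj u * cj c"
proof -
  define J :: "'a option \<Rightarrow> 'a option" where "J = moebius (mat2 0 (- 1) 1 0)"
  have JM: "J (moebius (mat2 a b c d) w) = moebius (mat2 (- c) (- d) a b) w" for w
    using moebius_neg_inverse nd by (simp add: J_def)
  have JJ: "J (J w) = w" for w
    by (cases w) (simp_all add: J_def nonzero_inverse_minus_eq)
  have "J ` extended V \<subseteq> extended V"
    using V(1) inv by (auto simp: J_def subspace_neg subspace_0 nonzero_inverse_minus_eq split: if_splits)
  then have JV: "J ` extended V = extended V"
    using JJ by (metis (no_types, opaque_lifting) image_eqI subset_antisym subsetD subsetI)
  have "moebius (mat2 (- c) (- d) a b) ` extended V = J ` (moebius (mat2 a b c d) ` extended V)"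
    unfolding image_image JM ..
  then have M': "moebius (mat2 (- c) (- d) a b) ` extended V = extended V"
    unfolding M JV .
  \<comment> \<open>Closure under inversion suffices, as \<open>cj z\<close> is a real multiple of
    \<open>inverse z\<close>.\<close>
  have cjV: "cj z \<in> V" if "z \<in> V" for z
  proof (cases "z = 0")
    case False
    then have "cj z = inverse z * (z * cj z)" by (simp add: mult.assoc[symmetric])
    also have "\<dots> = (norm z)\<^sup>2 *\<^sub>R inverse z" by (simp add: mult_cj of_real_def)
    finally show ?thesis using V(1) inv that by (simp add: subspace_scale)
  qed (use that in simp)
  have "scenter (- c) (- d) a b u = - cj (a * u * cj d + b * cj u * cj c)"
    by (simp add: scenter_def mult.assoc)
  then have "scenter (- c) (- d) a b u \<in> V"
    using subspace_neg[OF V(1) cjV[OF x]] by (simp only:)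
  moreover have "act (mat2 0 (- 1) 1 0) (act (mat2 a b c d) S) = act (mat2 (- c) (- d) a b) S"
    for S :: "'a osphere"
    unfolding act_def fst_conv snd_conv image_image JM[unfolded J_def] ..
  ultimately have "cobend V (act (mat2 a b c d) (S_u V u)) = sbend a b u"
    unfolding cobend_def using bend_act_S_u(1)[OF V _ M'] nd ndet_rows_swap by simp
  then show ?thesis
    using bend_act_S_u[OF V nd M] x of_real_sbend by (simp add: scenter_def)
qed

end

section \<open>The three groups\<close>

interpretation complex: conj_algebra cnj
  by standard (simp_all add: complex_norm_square[symmetric] del: of_real_power)

interpretation quat: conj_algebra qcnj
  by standard (auto simp: qcnj_def quat_eq_iff algebra_simps mult_qcnj[unfolded qcnj_def])

lemma SL2_C_ndet:
  assumes "mat2 a b c d \<in> SL2_C"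
  shows "complex.ndet a b c d = 1"
proof -
  have "a * d - b * c = 1"
    using assms by (simp add: SL2_C_def det_2)
  then have "(cmod (a * d - b * c))\<^sup>2 = 1" by simp
  moreover have "complex.ndet a b c d = (cmod (a * d - b * c))\<^sup>2"
    unfolding complex.ndet_def cmod_power2 by (simp add: inner_complex_def algebra_simps power2_eq_square)
  ultimately show ?thesis by simp
qed

lemma det_4:
  fixes A :: "'a::comm_ring_1^4^4"
  shows "det A =
    A$1$1 * (A$2$2 * (A$3$3*A$4$4 - A$3$4*A$4$3) - A$2$3 * (A$3$2*A$4$4 - A$3$4*A$4$2) + A$2$4 * (A$3$2*A$4$3 - A$3$3*A$4$2))
  - A$1$2 * (A$2$1 * (A$3$3*A$4$4 - A$3$4*A$4$3) - A$2$3 * (A$3$1*A$4$4 - A$3$4*A$4$1) + A$2$4 * (A$3$1*A$4$3 - A$3$3*A$4$1))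
  + A$1$3 * (A$2$1 * (A$3$2*A$4$4 - A$3$4*A$4$2) - A$2$2 * (A$3$1*A$4$4 - A$3$4*A$4$1) + A$2$4 * (A$3$1*A$4$2 - A$3$2*A$4$1))
  - A$1$4 * (A$2$1 * (A$3$2*A$4$3 - A$3$3*A$4$2) - A$2$2 * (A$3$1*A$4$3 - A$3$3*A$4$1) + A$2$3 * (A$3$1*A$4$2 - A$3$2*A$4$1))"
proof -
  have f: "finite {2, 3, 4::4}" "1 \<notin> {2, 3, 4::4}" "finite {3, 4::4}" "2 \<notin> {3, 4::4}"
    "finite {4::4}" "3 \<notin> {4::4}"
    by auto
  show ?thesis
    unfolding det_def UNIV_4
    unfolding sum_over_permutations_insert[OF f(1,2)] sum_over_permutations_insert[OF f(3,4)]
      sum_over_permutations_insert[OF f(5,6)] permutes_sing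
    by (simp add: sign_swap_id permutation_swap_id sign_compose sign_id swap_id_eq permutation_compose algebra_simps)
qed

text \<open>A polynomial identity in the 16 real coordinates. Comparing real parts is enough, since
  membership fixes the complex determinant to be 1.\<close>

lemma SL2_H_ndet:
  assumes "mat2 a b c d \<in> SL2_H"
  shows "quat.ndet a b c d = 1"
proof -
  have v4: "(vector [x, y, z, t] :: 'a::zero^4) $ 1 = x" "(vector [x, y, z, t] :: 'a^4) $ 2 = y"
    "(vector [x, y, z, t] :: 'a^4) $ 3 = z" "(vector [x, y, z, t] :: 'a^4) $ 4 = t" for x y z t
    by (simp_all add: vector_def)
  have "Re (det (complex_matrix (mat2 a b c d))) = quat.ndet a b c d"
    unfolding quat.ndet_def power2_norm_eq_inner det_4 complex_matrix_def v4 mat2_sel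
    by (simp add: inner_quat_def qalpha_def qbeta_def qcnj_def) (simp add: algebra_simps)
  then show ?thesis
    using assms by (simp add: SL2_H_def)
qed

section \<open>The orthogonal involution and the group of dimension 4\<close>

lemma qdagger_simps [simp]:
  "qdagger (x + y) = qdagger x + qdagger y" "qdagger (x * y) = qdagger y * qdagger x"
  "qdagger (- x) = - qdagger x" "qdagger (x - y) = qdagger x - qdagger y"
  "qdagger (r *\<^sub>R x) = r *\<^sub>R qdagger x" "qdagger 0 = 0" "qdagger 1 = 1"
  "qdagger (qdagger x) = x" "qdagger (qcnj x) = qcnj (qdagger x)"
  by (simp_all add: qdagger_def qcnj_def quat_eq_iff algebra_simps)

lemma norm_qdagger [simp]: "norm (qdagger x) = norm x"
  by (simp add: norm_quat_def inner_quat_def qdagger_def)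

lemma qdagger_inverse [simp]: "qdagger (inverse x) = inverse (qdagger x)"
  by (simp add: inverse_quat_def inner_quat_def qdagger_def qcnj_def quat_eq_iff)

lemma qdagger_eq_0_iff [simp]: "qdagger x = 0 \<longleftrightarrow> x = 0"
  by (metis norm_eq_zero norm_qdagger)

lemma SL2_dagger_H_relations:
  assumes "mat2 a b c d \<in> SL2_dagger_H"
  shows "qdagger d * a - qdagger b * c = 1" "qdagger d * b = qdagger b * d"
    "qdagger a * c = qdagger c * a" "qdagger a * d - qdagger c * b = 1"
    "a * qdagger d - b * qdagger c = 1"
    "d * qdagger c = c * qdagger d"
proof -
  have "hat_dagger (mat2 a b c d) ** mat2 a b c d = mat 1" "mat2 a b c d ** hat_dagger (mat2 a b c d) = mat 1"
    using assms by (auto simp: SL2_dagger_H_def)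
  then show "qdagger d * a - qdagger b * c = 1" "qdagger d * b = qdagger b * d"
    "qdagger a * c = qdagger c * a" "qdagger a * d - qdagger c * b = 1"
    "a * qdagger d - b * qdagger c = 1"
    "d * qdagger c = c * qdagger d"
    by (simp_all add: vec_eq_iff forall_2 matrix_matrix_mult_def sum_2 mat_def hat_dagger_def algebra_simps)
qed

text \<open>Expand the squared norm of \<open>a * qdagger d - b * qdagger c = 1\<close>; the
  symmetry \<open>d * qdagger c = c * qdagger d\<close> turns its cross term into that of
  \<open>ndet\<close>.\<close>

lemma SL2_dagger_H_ndet:
  assumes "mat2 a b c d \<in> SL2_dagger_H"
  shows "quat.ndet a b c d = 1"
proof -
  note rel = SL2_dagger_H_relations[OF assms]
  have *: "qdagger d * qcnj (qdagger c) = qcnj c * d"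
  proof (cases "c = 0")
    case False
    have "qcnj c * (d * qdagger c) * qcnj (qdagger c) = qcnj c * (c * qdagger d) * qcnj (qdagger c)"
      using rel by simp
    then have "(norm c)\<^sup>2 *\<^sub>R (qcnj c * d) = (norm c)\<^sup>2 *\<^sub>R (qdagger d * qcnj (qdagger c))"
      by (simp add: mult.assoc quat.cj_cancel)
    then show ?thesis using False by simp
  qed simp
  have "1 = (norm (a * qdagger d - b * qdagger c))\<^sup>2"
    using rel by simp
  also have "\<dots> = (norm a)\<^sup>2 * (norm d)\<^sup>2 + (norm b)\<^sup>2 * (norm c)\<^sup>2 - 2 * inner (a * qdagger d) (b * qdagger c)"
    unfolding power2_norm_eq_inner
    by (simp add: inner_diff inner_commute)
      (simp flip: power2_norm_eq_inner add: norm_mult power_mult_distrib)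
  also have "inner (a * qdagger d) (b * qdagger c) = quat.re (a * (qdagger d * qcnj (qdagger c)) * qcnj b)"
    using quat.re_mult_cj[of "a * qdagger d" "b * qdagger c"] by (simp add: mult.assoc)
  also have "\<dots> = quat.re (qcnj c * d * qcnj b * a)"
    unfolding * using quat.re_mult_commute[of a "qcnj c * d * qcnj b"] by (simp add: mult.assoc)
  finally show ?thesis by (simp add: quat.ndet_def)
qed

text \<open>\<open>qdagger\<close> reverses products and turns the right fraction
  \<open>x * inverse y\<close> into a left fraction. The first hypothesis is equality of a left and
  a right fraction, cross-multiplied.\<close>

lemma qdagger_hom_point:
  assumes "qdagger y * x' = qdagger x * y'" "y = 0 \<longleftrightarrow> y' = 0"
  shows "map_option qdagger (hom_point x y) = hom_point x' y'"
proof (cases "y = 0")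
  case False
  have "inverse (qdagger y) * (qdagger y * x') * inverse y' = inverse (qdagger y) * (qdagger x * y') * inverse y'"
    using assms by simp
  then have "x' * inverse y' = inverse (qdagger y) * qdagger x"
    using False assms(2) by (metis left_inverse right_inverse mult.assoc mult_1_left mult_1_right qdagger_eq_0_iff)
  then show ?thesis using False assms by (simp add: hom_point_def)
qed (use assms in \<open>simp add: hom_point_def\<close>)

text \<open>The involution is equivariant on all of the quaternions, not just on its fixed space.\<close>

lemma moebius_qdagger:
  assumes M: "mat2 a b c d \<in> SL2_dagger_H"
  shows "moebius (mat2 a b c d) (map_option qdagger w) = map_option qdagger (moebius (mat2 a b c d) w)"
proof -
  note rel = SL2_dagger_H_relations[OF M]
  have nd: "quat.ndet a b c d \<noteq> 0" using SL2_dagger_H_ndet[OF M] by simp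
  obtain x y x' y' where xy: "(x, y) \<noteq> (0, 0)" "w = hom_point x y"
    and xy': "(x', y') \<noteq> (0, 0)" "map_option qdagger w = hom_point x' y'"
    and *: "qdagger y * x' = qdagger x * y'"
  proof (cases w)
    case None
    then show ?thesis using that[of 1 0 1 0] by (simp add: hom_point_def)
  next
    case (Some z)
    then show ?thesis using that[of z 1 "qdagger z" 1] by (simp add: hom_point_def)
  qed
  let ?p = "a * x + b * y" and ?q = "c * x + d * y" and ?p' = "a * x' + b * y'" and ?q' = "c * x' + d * y'"
  \<comment> \<open>The group relations kill the terms purely in \<open>x, x'\<close> or
    \<open>y, y'\<close>, and reduce the mixed ones to relation \<open>*\<close> for the
    arguments.\<close>
  have "qdagger ?q * ?p' - qdagger ?p * ?q' = 
     qdagger x * (qdagger c * a - qdagger a * c) * x' + qdagger y * (qdagger d * b - qdagger b * d) * y'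
     - qdagger x * (qdagger a * d - qdagger c * b) * y' + qdagger y * (qdagger d * a - qdagger b * c) * x'"
    by (simp add: algebra_simps)
  also have "\<dots> = 0" unfolding rel using * by simp
  finally have eq: "qdagger ?q * ?p' = qdagger ?p * ?q'" by simp
  have ne: "(?p, ?q) \<noteq> (0, 0)" "(?p', ?q') \<noteq> (0, 0)"
    using quat.mat2_kernel nd xy(1) xy'(1) by blast+
  have "?q = 0 \<longleftrightarrow> ?q' = 0"
    using eq ne by (metis mult_eq_0_iff qdagger_eq_0_iff)
  then show ?thesis
    unfolding xy'(2) unfolding xy(2) moebius_hom_point[OF xy(1)] moebius_hom_point[OF xy'(1)]
    using qdagger_hom_point[OF eq] by simp
qed

lemma subspace_Rplus4: "subspace Rplus4"
  by (auto simp: Rplus4_def subspace_def)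

lemma extended_Rplus4: "w \<in> extended Rplus4 \<longleftrightarrow> map_option qdagger w = w"
  by (cases w) (auto simp: Rplus4_def)

text \<open>\<open>extended Rplus4\<close> is the fixed set of an involution commuting with the
  bijection \<open>moebius (mat2 a b c d)\<close>, so it is mapped onto itself.\<close>

lemma moebius_Rplus4:
  assumes M: "mat2 a b c d \<in> SL2_dagger_H"
  shows "moebius (mat2 a b c d) ` extended Rplus4 = extended Rplus4"
proof -
  have bij: "bij (moebius (mat2 a b c d))"
    using quat.bij_moebius SL2_dagger_H_ndet[OF M] by simp
  have iff: "moebius (mat2 a b c d) w \<in> extended Rplus4 \<longleftrightarrow> w \<in> extended Rplus4" for w
    unfolding extended_Rplus4 moebius_qdagger[OF M, symmetric] using bij by (simp add: bij_is_inj inj_eq)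
  show ?thesis
  proof (intro equalityI subsetI)
    fix w assume w: "w \<in> extended Rplus4"
    obtain v where "w = moebius (mat2 a b c d) v" using bij by (metis bij_pointE)
    then show "w \<in> moebius (mat2 a b c d) ` extended Rplus4" using w iff by blast
  next
    fix w assume "w \<in> moebius (mat2 a b c d) ` extended Rplus4"
    then show "w \<in> extended Rplus4"
      by (elim imageE) (simp only: iff)
  qed
qed

text \<open>The relations of the group turn \<open>\<xi> * qcnj (qdagger \<xi>)\<close> into \<open>1 + \<kappa> \<kappa>'\<close>, which is also
  \<open>\<xi> * qcnj \<xi>\<close> by the discriminant identity.\<close>

lemma scenter_Rplus4:
  assumes M: "mat2 a b c d \<in> SL2_dagger_H" and u: "u \<in> Rplus4" "norm u = 1"
  shows "quat.scenter a b c d u \<in> Rplus4"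
proof (cases "quat.scenter a b c d u = 0")
  case True
  then show ?thesis using subspace_0[OF subspace_Rplus4] by simp
next
  case False
  note rel = SL2_dagger_H_relations[OF M]
  \<comment> \<open>As a composite of two anti-automorphisms, \<open>s\<close> is an automorphism;
    it carries the group relations to the relations \<open>srel\<close> adapted to
    \<open>\<xi> * s \<xi>\<close>.\<close>
  define s where "s x = qcnj (qdagger x)" for x
  define \<xi> where "\<xi> = quat.scenter a b c d u"
  have srel: "qcnj d * s a = 1 + qcnj b * s c" "qcnj d * s b = qcnj b * s d"
    "qcnj c * s a = qcnj a * s c" "qcnj c * s b = qcnj a * s d - 1"
    using rel(1-4)[THEN arg_cong[of _ _ s]] by (simp_all add: s_def algebra_simps)
  have uu: "u * qcnj u = 1" "qcnj u * u = 1" "u * (qcnj u * x) = x" "qcnj u * (u * x) = x" for x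
    using u by (simp_all add: quat.cj_cancel)
  have [simp]: "qdagger u = u" using u by (simp add: Rplus4_def)
  let ?k = "quat.sbend c d u"
  \<comment> \<open>The bend is real, hence fixed by \<open>qdagger\<close>; applying
    \<open>qdagger\<close> to its formula gives this second expression.\<close>
  have k: "of_real ?k = s c * qcnj u * qdagger d + s d * u * qdagger c"
    using arg_cong[OF quat.of_real_sbend[of c d u], of qdagger]
    by (simp add: s_def mult.assoc of_real_def)
  have "\<xi> * s \<xi> = a * u * (qcnj d * s a) * qcnj u * qdagger d + a * u * (qcnj d * s b) * u * qdagger c
    + b * qcnj u * (qcnj c * s a) * qcnj u * qdagger d + b * qcnj u * (qcnj c * s b) * u * qdagger c"
    by (simp add: \<xi>_def quat.scenter_def s_def algebra_simps)
  also have "\<dots> = (a * qdagger d - b * qdagger c) + (a * u * qcnj b + b * qcnj u * qcnj a) * of_real ?k"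
    unfolding srel k by (simp add: algebra_simps uu)
  also have "\<dots> = of_real (1 + quat.sbend a b u * ?k)"
    unfolding rel quat.of_real_sbend[symmetric] by simp
  also have "\<dots> = of_real ((norm \<xi>)\<^sup>2)"
    using quat.discriminant[of a b c d u] SL2_dagger_H_ndet[OF M] u
    by (simp add: \<xi>_def algebra_simps)
  also have "\<dots> = \<xi> * qcnj \<xi>" by (simp add: mult_qcnj)
  \<comment> \<open>Cancel the nonzero left factor \<open>\<xi>\<close>.\<close>
  finally have "s \<xi> = qcnj \<xi>" using False by (simp add: \<xi>_def)
  then have "qdagger \<xi> = \<xi>" unfolding s_def by (metis quat.cj_cj)
  then show ?thesis by (simp add: Rplus4_def \<xi>_def)
qed

theorem theorem4p9:
  shows
    "(\<forall>(u::complex) a b c d. norm u = 1 \<and> mat2 a b c d \<in> SL2_C \<longrightarrow>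
        of_real (bend UNIV (act (mat2 a b c d) (S_u UNIV u))) = c * u * cnj d + d * cnj u * cnj c \<and>
        of_real (cobend UNIV (act (mat2 a b c d) (S_u UNIV u))) = a * u * cnj b + b * cnj u * cnj a \<and>
        bend_center UNIV (act (mat2 a b c d) (S_u UNIV u)) = a * u * cnj d + b * cnj u * cnj c) \<and>
     (\<forall>u\<in>Rplus4. \<forall>a b c d. norm u = 1 \<and> mat2 a b c d \<in> SL2_dagger_H \<longrightarrow>
        of_real (bend Rplus4 (act (mat2 a b c d) (S_u Rplus4 u))) = c * u * qcnj d + d * qcnj u * qcnj c \<and>
        of_real (cobend Rplus4 (act (mat2 a b c d) (S_u Rplus4 u))) = a * u * qcnj b + b * qcnj u * qcnj a \<and>
        bend_center Rplus4 (act (mat2 a b c d) (S_u Rplus4 u)) = a * u * qcnj d + b * qcnj u * qcnj c) \<and>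
     (\<forall>(u::quat) a b c d. norm u = 1 \<and> mat2 a b c d \<in> SL2_H \<longrightarrow>
        of_real (bend UNIV (act (mat2 a b c d) (S_u UNIV u))) = c * u * qcnj d + d * qcnj u * qcnj c \<and>
        of_real (cobend UNIV (act (mat2 a b c d) (S_u UNIV u))) = a * u * qcnj b + b * qcnj u * qcnj a \<and>
        bend_center UNIV (act (mat2 a b c d) (S_u UNIV u)) = a * u * qcnj d + b * qcnj u * qcnj c)"
proof -
  have C: "of_real (bend UNIV (act (mat2 a b c d) (S_u UNIV u))) = c * u * cnj d + d * cnj u * cnj c \<and>
      of_real (cobend UNIV (act (mat2 a b c d) (S_u UNIV u))) = a * u * cnj b + b * cnj u * cnj a \<and>
      bend_center UNIV (act (mat2 a b c d) (S_u UNIV u)) = a * u * cnj d + b * cnj u * cnj c"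
    if u: "norm u = 1" and M: "mat2 a b c d \<in> SL2_C" for u a b c d :: complex
  proof (rule complex.bend_cobend_center_act_S_u[OF subspace_UNIV UNIV_I u UNIV_I SL2_C_ndet[OF M] _ UNIV_I])
    show "moebius (mat2 a b c d) ` extended UNIV = extended UNIV"
      by (rule complex.moebius_UNIV) (simp add: SL2_C_ndet[OF M])
  qed
  have D: "of_real (bend Rplus4 (act (mat2 a b c d) (S_u Rplus4 u))) = c * u * qcnj d + d * qcnj u * qcnj c \<and>
      of_real (cobend Rplus4 (act (mat2 a b c d) (S_u Rplus4 u))) = a * u * qcnj b + b * qcnj u * qcnj a \<and>
      bend_center Rplus4 (act (mat2 a b c d) (S_u Rplus4 u)) = a * u * qcnj d + b * qcnj u * qcnj c"
    if u: "u \<in> Rplus4" "norm u = 1" and M: "mat2 a b c d \<in> SL2_dagger_H" for u a b c d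
  proof (rule quat.bend_cobend_center_act_S_u[OF subspace_Rplus4 u])
    show "inverse x \<in> Rplus4" if "x \<in> Rplus4" for x
      using that by (simp add: Rplus4_def)
    show "a * u * qcnj d + b * qcnj u * qcnj c \<in> Rplus4"
      using scenter_Rplus4[OF M u] by (simp add: quat.scenter_def)
  qed (rule SL2_dagger_H_ndet[OF M] moebius_Rplus4[OF M])+
  have H: "of_real (bend UNIV (act (mat2 a b c d) (S_u UNIV u))) = c * u * qcnj d + d * qcnj u * qcnj c \<and>
      of_real (cobend UNIV (act (mat2 a b c d) (S_u UNIV u))) = a * u * qcnj b + b * qcnj u * qcnj a \<and>
      bend_center UNIV (act (mat2 a b c d) (S_u UNIV u)) = a * u * qcnj d + b * qcnj u * qcnj c"
    if u: "norm u = 1" and M: "mat2 a b c d \<in> SL2_H" for u a b c d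
  proof (rule quat.bend_cobend_center_act_S_u[OF subspace_UNIV UNIV_I u UNIV_I SL2_H_ndet[OF M] _ UNIV_I])
    show "moebius (mat2 a b c d) ` extended UNIV = extended UNIV"
      by (rule quat.moebius_UNIV) (simp add: SL2_H_ndet[OF M])
  qed
  show ?thesis
    by (rule conjI[OF _ conjI]; intro allI ballI impI; elim conjE; rule C D H; assumption)
qed

end
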